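(* Let $m\in[-1,1]$ and let $r,s,s'$ be natural numbers such that $T_{s'}(m)=T_s(m)$. Then for every integer $i\ge 1$, $$T_{s'}^i(m)=T_s^i(m)\qquad\text{and}\qquad T_{s'}^i(T_r(m))=T_r(T_s^i(m))=T_s^i(T_r(m)).$$ (Hence, when $m$ and $T_r(m)$ are public, an adversary knowing such an $s'$ can produce the user's valid authentication pair $(T_s^i(m),T_s^i(T_r(m)))$ for every session $i$.)
   Context: For $n\in\mathbb{N}$ (with $0\in\mathbb{N}$), the Chebyshev polynomial $T_n:[-1,1]\to[-1,1]$ is defined recursively by $T_0(x)=1$, $T_1(x)=x$, $T_n(x)=2x\,T_{n-1}(x)-T_{n-2}(x)$ for $n\ge 2$; equivalently $T_n(x)=\cos(n\arccos(x))$. $T_s^i$ denotes the map $T_s$ composed with itself $i$ times, so that $T_s^i=T_{s^i}$. In the authentication scheme considered, the server holds a secret integer $r$ and gives $T_r(m)$ to the user; the user holds a secret integer $s$ and in the $i$-th session sends $T_s^i(m)$ and $auth=T_s^i(T_r(m))$; the server accepts if $auth=T_r(T_s^i(m))$. *)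

theory Defs
  imports Complex_Main
begin

(* The recursion makes sense on all reals; the Chebyshev map proper is its restriction to
   the interval from -1 to 1, which it maps to itself (chebyshev_T_range). *)
fun chebyshev_T :: "nat \<Rightarrow> real \<Rightarrow> real" where
  "chebyshev_T 0 x = 1"
| "chebyshev_T (Suc 0) x = x"
| "chebyshev_T (Suc (Suc n)) x = 2 * x * chebyshev_T (Suc n) x - chebyshev_T n x"

lemma chebyshev_T_cos: "chebyshev_T n (cos t) = cos (real n * t)"
proof (induction n "cos t" rule: chebyshev_T.induct)
  case (3 n)
  have "cos (real (Suc n) * t + t) + cos (real (Suc n) * t - t) = 2 * cos t * cos (real (Suc n) * t)"
    by (simp add: cos_add cos_diff)
  with 3 show ?case by (simp add: algebra_simps)
qed simp_all

lemma chebyshev_T_arccos: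
  assumes "x \<in> {-1..1}"
  shows "chebyshev_T n x = cos (real n * arccos x)"
  using assms chebyshev_T_cos[of n "arccos x"] by simp

lemma chebyshev_T_range:
  assumes "x \<in> {-1..1}"
  shows "chebyshev_T n x \<in> {-1..1}"
  using assms by (simp add: chebyshev_T_arccos)

(* The pair (message, auth) sent in session i by somebody who uses the exponent k, given the
   seed x and the value y issued by the server; for the legitimate user, y is T_r(x). *)
definition session_pair :: "nat \<Rightarrow> nat \<Rightarrow> real \<Rightarrow> real \<Rightarrow> real \<times> real" where
  "session_pair k i x y = ((chebyshev_T k ^^ i) x, (chebyshev_T k ^^ i) y)"

definition server_accepts :: "nat \<Rightarrow> real \<times> real \<Rightarrow> bool" where
  "server_accepts r p \<longleftrightarrow> snd p = chebyshev_T r (fst p)"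

end

(* On [-1,1] the Chebyshev maps form a commuting family closed under composition, so the value
   at m of any iterate of T_s', and of T_s' after T_r, depends on s' only through T_s'(m). *)
theory Submission
  imports Defs
begin

text \<open>Writing \<open>x = cos t\<close> turns \<open>chebyshev_T n\<close> into multiplication
  of the angle by \<open>n\<close>, so these maps commute on [-1,1]. Commuting moves each
  \<open>s'\<close> inward to \<open>m\<close>, where it can be replaced by \<open>s\<close>; moving
  \<open>r\<close> outward past the iterates then settles the values at
  \<open>chebyshev_T r m\<close>.\<close>

text \<open>\<open>chebyshev_T_cos\<close> holds for every real angle, so it does not matter that
  \<open>b * arccos x\<close> may leave [0,pi].\<close>

lemma chebyshev_T_comp:
  assumes "x \<in> {-1..1}"
  shows "chebyshev_T a (chebyshev_T b x) = chebyshev_T (a * b) x"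
  by (simp add: chebyshev_T_arccos[OF assms] chebyshev_T_cos mult.assoc)

lemma chebyshev_T_commute:
  assumes "x \<in> {-1..1}"
  shows "chebyshev_T a (chebyshev_T b x) = chebyshev_T b (chebyshev_T a x)"
  by (simp add: chebyshev_T_comp[OF assms] mult.commute)

lemma chebyshev_T_funpow:
  assumes "x \<in> {-1..1}"
  shows "(chebyshev_T k ^^ i) x = chebyshev_T (k ^ i) x"
  by (induction i) (simp_all add: chebyshev_T_comp[OF assms])

lemma chebyshev_T_funpow_cong:
  assumes "x \<in> {-1..1}" and "chebyshev_T s' x = chebyshev_T s x"
  shows "(chebyshev_T s' ^^ i) x = (chebyshev_T s ^^ i) x"
proof (induction i)
  case (Suc i)
  have "(chebyshev_T s' ^^ Suc i) x = chebyshev_T s' (chebyshev_T (s ^ i) x)"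
    using Suc by (simp add: chebyshev_T_funpow[OF assms(1)])
  \<comment> \<open>The two maps are only known to agree at \<open>x\<close>, so \<open>s'\<close>
    is first commuted inward to act on \<open>x\<close> itself.\<close>
  also have "\<dots> = chebyshev_T (s ^ i) (chebyshev_T s x)"
    by (simp only: chebyshev_T_commute[OF assms(1), of s'] assms(2))
  also have "\<dots> = (chebyshev_T s ^^ Suc i) x"
    by (simp add: chebyshev_T_funpow[OF assms(1)] chebyshev_T_commute[OF assms(1), of s])
  finally show ?case .
qed simp

text \<open>Both iterates collapse to the index \<open>k ^ i\<close>; at
  \<open>chebyshev_T r x\<close> this is possible because that value stays in [-1,1].\<close>

lemma chebyshev_T_funpow_commute:
  assumes "x \<in> {-1..1}"
  shows "(chebyshev_T k ^^ i) (chebyshev_T r x) = chebyshev_T r ((chebyshev_T k ^^ i) x)"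
  using chebyshev_T_commute[OF assms]
  by (simp add: chebyshev_T_funpow[OF assms] chebyshev_T_funpow[OF chebyshev_T_range[OF assms]])

theorem mainTheorem5:
  fixes m :: real and r s s' :: nat
  assumes "m \<in> {-1..1}"
    and "chebyshev_T s' m = chebyshev_T s m"
  shows "\<forall>i::nat. i \<ge> 1 \<longrightarrow>
      (chebyshev_T s' ^^ i) m = (chebyshev_T s ^^ i) m
    \<and> (chebyshev_T s' ^^ i) (chebyshev_T r m) = chebyshev_T r ((chebyshev_T s ^^ i) m)
    \<and> chebyshev_T r ((chebyshev_T s ^^ i) m) = (chebyshev_T s ^^ i) (chebyshev_T r m)
    \<and> session_pair s' i m (chebyshev_T r m) = session_pair s i m (chebyshev_T r m)
    \<and> server_accepts r (session_pair s' i m (chebyshev_T r m))"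
  using chebyshev_T_funpow_cong[OF assms] chebyshev_T_funpow_commute[OF assms(1)]
  by (simp add: session_pair_def server_accepts_def)

end
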